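(* Let $P_m$ be the distribution on $S_n$ of a shelf shuffle with $n$ cards and $m$ shelves, and let $U$ be the uniform distribution on $S_n$. Fix $0<c<\infty$ and suppose the number of shelves is $m=cn^{3/2}$ (an integer). Then as $n\to\infty$, \[ \max_{w\in S_n}\left|1-\frac{P_m(w)}{U(w)}\right|\sim e^{1/(12c^2)}-1,\qquad \max_{w\in S_n}\left(1-\frac{P_m(w)}{U(w)}\right)\sim 1-e^{-1/(24c^2)}, \] where $a_n\sim b_n$ means $a_n/b_n\to1$.
   Context: Shelf shuffle with $m$ shelves of a deck of $n$ cards, initially in order $1,\dots,n$ from top to bottom: each card independently gets a label uniform in $\{1,\dots,2m\}$; the new deck consists, from top to bottom, of the cards labeled $1$ in increasing order, then those labeled $2$ in decreasing order, then those labeled $3$ in increasing order, etc. (label $j$ packet increasing if $j$ odd, decreasing if $j$ even). The outcome is the permutation $w$ with $w(i)$ the card in position $i$ from the top; $U(w)=1/n!$. *)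

theory Defs
  imports "HOL-Probability.Probability" "HOL-Combinatorics.Permutations"
    "HOL-Library.Landau_Symbols"
begin

definition packet :: "nat \<Rightarrow> (nat \<Rightarrow> nat) \<Rightarrow> nat \<Rightarrow> nat list" where
  "packet n l j = (let cards = filter (\<lambda>k. l k = j) [1..<Suc n]
                   in if odd j then cards else rev cards)"

(* The deck after the shuffle, listed from top to bottom, if card k gets label l k. *)
definition shelf_deck :: "nat \<Rightarrow> nat \<Rightarrow> (nat \<Rightarrow> nat) \<Rightarrow> nat list" where
  "shelf_deck n m l = concat (map (packet n l) [1..<Suc (2 * m)])"

(* Positions and cards are numbered from 1, list entries from 0. Outside {1..n} the function is
   the identity, in line with the predicate permutes. *)
definition shelf_perm :: "nat \<Rightarrow> nat \<Rightarrow> (nat \<Rightarrow> nat) \<Rightarrow> nat \<Rightarrow> nat" where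
  "shelf_perm n m l i = (if i \<in> {1..n} then shelf_deck n m l ! (i - 1) else i)"

definition sym_group :: "nat \<Rightarrow> (nat \<Rightarrow> nat) set" where
  "sym_group n = {w. w permutes {1..n}}"

(* Product of uniform label distributions. The second argument of Pi_pmf only sets the irrelevant
   value of the labelling outside {1..n}. Meaningful for m > 0, as there are no labels if m = 0. *)
definition shelf_shuffle_pmf :: "nat \<Rightarrow> nat \<Rightarrow> (nat \<Rightarrow> nat) pmf" where
  "shelf_shuffle_pmf n m =
     map_pmf (shelf_perm n m) (Pi_pmf {1..n} 0 (\<lambda>_. pmf_of_set {1..2 * m}))"

definition uniform_perm_pmf :: "nat \<Rightarrow> (nat \<Rightarrow> nat) pmf" where
  "uniform_perm_pmf n = pmf_of_set (sym_group n)"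

end

(* A labelling produces w iff the labels read along w increase weakly, an equal pair of neighbours
   being allowed only for odd labels at an ascent and even labels at a descent. Adding the cards one
   by one, the generating function in m of the number of such labellings is
   2 * 4^v * t^(v+1) * (1+t)^k / (1-t)^(n+1), where v is the number of valleys of w and
   k = n - 1 - 2 v. Extracting the coefficient gives P_m(w) / U(w) as the expectation of
   prod_j (1 + (j - (n+1)/2 - d) / m) with d a centred Bin(k, 1/2) variable. With m = c n^(3/2) the
   logarithm of the product is -d n / m - 1 / (24 c^2) up to negligible terms, so the ratio is close
   to exp (-1 / (24 c^2)) * cosh (1 / (2 c sqrt n))^k uniformly in k. The extreme values are at
   k = n - 1 (the identity), with limit exp (1 / (12 c^2)), and k <= 1, with limit
   exp (-1 / (24 c^2)). *)
theory Submission
  imports Defs "HOL-Computational_Algebra.Formal_Power_Series" "HOL-Real_Asymp.Real_Asymp"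
begin

section \<open>Labellings and the shuffled deck\<close>

text \<open>Two different heads would each be related to the other, against asymmetry. Asymmetry
  also keeps a head out of its own tail, so the tails have equal sets and induction applies.\<close>

lemma sorted_wrt_unique:
  assumes "asymp R" "sorted_wrt R xs" "sorted_wrt R ys" "set xs = set ys"
  shows "xs = ys"
  using assms(2-)
proof (induction xs arbitrary: ys)
  case (Cons x xs)
  then obtain y ys' where ys: "ys = y # ys'"
    by (cases ys) auto
  have "x = y"
  proof (rule ccontr)
    assume "x \<noteq> y"
    then have "R y x" "R x y"
      using Cons.prems ys by auto
    with assms(1) show False
      by (auto dest: asympD)
  qed
  moreover have "x \<notin> set xs" "y \<notin> set ys'"
    using Cons.prems ys assms(1) by (auto dest: asympD)
  ultimately have "set xs = set ys'"
    using Cons.prems(3) ys by auto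
  with Cons \<open>x = y\<close> ys show ?case
    by auto
qed simp

lemma sorted_wrt_asymp_distinct:
  assumes "asymp R" "sorted_wrt R xs"
  shows "distinct xs"
  using assms(2)
proof (induction xs)
  case (Cons x xs)
  have "\<not> R x x" using assms(1) by (meson asympD)
  with Cons show ?case by auto
qed simp

text \<open>The strict order in which the shuffle lays out the cards; it lets the deck be described
  as a sorted list instead of entry by entry.\<close>

definition deck_less :: "(nat \<Rightarrow> nat) \<Rightarrow> nat \<Rightarrow> nat \<Rightarrow> bool" where
  "deck_less l x y \<longleftrightarrow> l x < l y \<or> l x = l y \<and> (if odd (l x) then x < y else y < x)"

lemma asymp_deck_less: "asymp (deck_less l)"
proof (rule asympI)
  fix x y
  assume xy: "deck_less l x y"
  show "\<not> deck_less l y x"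
  proof (cases "l x = l y")
    case True
    then show ?thesis
      using xy unfolding deck_less_def by (simp split: if_splits)
  next
    case False
    then show ?thesis
      using xy unfolding deck_less_def by simp
  qed
qed

lemma transp_deck_less: "transp (deck_less l)"
proof (rule transpI)
  fix x y z
  assume xy: "deck_less l x y" and yz: "deck_less l y z"
  show "deck_less l x z"
  proof (cases "l x = l y \<and> l y = l z")
    case True
    then show ?thesis
      using xy yz unfolding deck_less_def by (simp split: if_splits)
  next
    case False
    then have "l x < l z"
      using xy yz unfolding deck_less_def by linarith
    then show ?thesis
      unfolding deck_less_def by simp
  qed
qed

lemma set_packet: "set (packet n l j) = {k \<in> {1..n}. l k = j}"
  by (auto simp: packet_def Let_def)

lemma sorted_packet: "sorted_wrt (deck_less l) (packet n l j)"
proof -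
  define cards where "cards = filter (\<lambda>k. l k = j) [1..<Suc n]"
  have "sorted_wrt (<) cards" and label: "\<forall>k\<in>set cards. l k = j"
    by (simp_all add: cards_def sorted_wrt_filter del: upt_Suc)
  then have "sorted_wrt (\<lambda>x y. if odd j then deck_less l x y else deck_less l y x) cards"
    by (elim sorted_wrt_mono_rel[rotated]) (auto simp: deck_less_def)
  then show ?thesis
    by (cases "odd j") (simp_all add: packet_def Let_def sorted_wrt_rev cards_def del: upt_Suc)
qed

lemma sorted_wrt_concat_packets:
  assumes "sorted_wrt (<) js"
  shows "sorted_wrt (deck_less l) (concat (map (packet n l) js))"
  using assms
  by (induction js) (auto simp: sorted_wrt_append sorted_packet set_packet deck_less_def)

lemma sorted_shelf_deck: "sorted_wrt (deck_less l) (shelf_deck n m l)"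
  unfolding shelf_deck_def by (intro sorted_wrt_concat_packets sorted_wrt_upt)

lemma set_shelf_deck:
  assumes "l \<in> {1..n} \<rightarrow> {1..2 * m}"
  shows "set (shelf_deck n m l) = {1..n}"
  using assms by (auto simp: shelf_deck_def set_packet Pi_iff less_Suc_eq_le simp del: upt_Suc)

text \<open>The deck is the only list sorted by \<open>deck_less\<close> whose set is
  \<open>{1..n}\<close>, and \<open>w\<close> lists the same cards.\<close>

lemma shelf_perm_eq_iff_sorted:
  assumes w: "w permutes {1..n}" and l: "l \<in> {1..n} \<rightarrow> {1..2 * m}"
  shows "shelf_perm n m l = w \<longleftrightarrow> sorted_wrt (deck_less l) (map w [1..<Suc n])"
proof -
  have "length (shelf_deck n m l) = card (set (shelf_deck n m l))"
    using distinct_card[OF sorted_wrt_asymp_distinct[OF asymp_deck_less sorted_shelf_deck]] by simp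
  then have len: "length (shelf_deck n m l) = n"
    by (simp add: set_shelf_deck[OF l])
  have set: "set (shelf_deck n m l) = set (map w [1..<Suc n])"
    using permutes_image[OF w] set_shelf_deck[OF l]
    by (simp add: atLeastLessThanSuc_atLeastAtMost del: upt_Suc)
  have "shelf_perm n m l = w \<longleftrightarrow> shelf_deck n m l = map w [1..<Suc n]"
  proof
    assume *: "shelf_perm n m l = w"
    show "shelf_deck n m l = map w [1..<Suc n]"
      by (rule nth_equalityI) (auto simp: len * [symmetric] shelf_perm_def simp del: upt_Suc)
  next
    assume *: "shelf_deck n m l = map w [1..<Suc n]"
    show "shelf_perm n m l = w"
      using permutes_not_in[OF w] by (auto simp: fun_eq_iff shelf_perm_def * simp del: upt_Suc)
  qed
  also have "\<dots> \<longleftrightarrow> sorted_wrt (deck_less l) (map w [1..<Suc n])"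
    using sorted_wrt_unique[OF asymp_deck_less sorted_shelf_deck _ set] sorted_shelf_deck by metis
  finally show ?thesis .
qed

definition label_step :: "bool \<Rightarrow> nat \<Rightarrow> nat \<Rightarrow> bool" where
  "label_step d x y \<longleftrightarrow> x < y \<or> x = y \<and> (odd x \<longleftrightarrow> \<not> d)"

definition descent :: "(nat \<Rightarrow> nat) \<Rightarrow> nat \<Rightarrow> bool" where
  "descent w j \<longleftrightarrow> w (Suc (Suc j)) < w (Suc j)"

text \<open>Transitivity reduces sortedness to neighbours, and injectivity of \<open>w\<close> makes
  each neighbouring pair an ascent or a descent.\<close>

lemma shelf_perm_eq_iff:
  assumes w: "w permutes {1..n}" and l: "l \<in> {1..n} \<rightarrow> {1..2 * m}"
  shows "shelf_perm n m l = w \<longleftrightarrow>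
    (\<forall>j. Suc j < n \<longrightarrow> label_step (descent w j) (l (w (Suc j))) (l (w (Suc (Suc j)))))"
proof -
  have "w (Suc (Suc j)) \<noteq> w (Suc j)" "w (Suc j) \<noteq> w (Suc (Suc j))" for j
    using injD[OF permutes_inj[OF w], of "Suc j" "Suc (Suc j)"] by auto
  then have "deck_less l (w (Suc j)) (w (Suc (Suc j))) \<longleftrightarrow>
      label_step (descent w j) (l (w (Suc j))) (l (w (Suc (Suc j))))" for j
    by (auto simp: deck_less_def label_step_def descent_def not_less_iff_gr_or_eq)
  then show ?thesis
    unfolding shelf_perm_eq_iff_sorted[OF assms] sorted_wrt_iff_nth_Suc_transp[OF transp_deck_less]
    by (simp del: upt_Suc)
qed

section \<open>Counting the labellings that produce a permutation\<close>

text \<open>Positions are counted from 0 here: \<open>a j\<close> is the label of the card in position \<open>j + 1\<close> of the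
  shuffled deck, and \<open>D j\<close> says that this card is larger than the next one.\<close>

definition shelf_words :: "(nat \<Rightarrow> bool) \<Rightarrow> nat \<Rightarrow> nat \<Rightarrow> (nat \<Rightarrow> nat) set" where
  "shelf_words D i x = {a. (\<forall>j\<le>i. 1 \<le> a j) \<and> (\<forall>j>i. a j = 0) \<and>
     (\<forall>j<i. label_step (D j) (a j) (a (Suc j))) \<and> a i = x}"

lemma shelf_words_0: "shelf_words D 0 (Suc x) = {(\<lambda>_. 0)(0 := Suc x)}"
  by (auto simp: shelf_words_def fun_eq_iff)

text \<open>Resetting the last label to 0 leaves a shorter word. Its last label ranges over an
  initial segment of the positive labels, which contains \<open>Suc x\<close> exactly when this step
  permits an equal pair.\<close>

lemma shelf_words_Suc:
  "shelf_words D (Suc i) (Suc x) =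
     (\<Union>y\<in>{1..if odd (Suc x) \<longleftrightarrow> \<not> D i then Suc x else x}. (\<lambda>a. a(Suc i := Suc x)) ` shelf_words D i y)"
proof (intro equalityI subsetI)
  fix a assume a: "a \<in> shelf_words D (Suc i) (Suc x)"
  then have "label_step (D i) (a i) (Suc x)" "1 \<le> a i"
    by (auto simp: shelf_words_def)
  moreover have "a(Suc i := 0) \<in> shelf_words D i (a i)"
    using a by (auto simp: shelf_words_def le_Suc_eq)
  moreover have "a = (a(Suc i := 0))(Suc i := Suc x)"
    using a by (auto simp: shelf_words_def fun_eq_iff)
  ultimately show "a \<in> (\<Union>y\<in>{1..if odd (Suc x) \<longleftrightarrow> \<not> D i then Suc x else x}. (\<lambda>a. a(Suc i := Suc x)) ` shelf_words D i y)"
    by (intro UN_I[of "a i"] image_eqI[of _ _ "a(Suc i := 0)"])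
       (auto simp: label_step_def split: if_splits)
next
  fix a assume "a \<in> (\<Union>y\<in>{1..if odd (Suc x) \<longleftrightarrow> \<not> D i then Suc x else x}. (\<lambda>a. a(Suc i := Suc x)) ` shelf_words D i y)"
  then obtain y b where y: "1 \<le> y" "y \<le> (if odd (Suc x) \<longleftrightarrow> \<not> D i then Suc x else x)"
    and b: "b \<in> shelf_words D i y" and a: "a = b(Suc i := Suc x)"
    by auto
  have "label_step (D i) y (Suc x)"
    using y by (auto simp: label_step_def split: if_splits)
  with b show "a \<in> shelf_words D (Suc i) (Suc x)"
    by (auto simp: shelf_words_def a le_Suc_eq less_Suc_eq)
qed

lemma finite_shelf_words: "finite (shelf_words D i x)"
proof (induction i arbitrary: x)
  case 0
  have "shelf_words D 0 0 = {}" by (auto simp: shelf_words_def)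
  then show ?case by (cases x) (auto simp: shelf_words_0)
next
  case (Suc i)
  show ?case
  proof (cases x)
    case 0
    then have "shelf_words D (Suc i) x = {}" by (auto simp: shelf_words_def)
    then show ?thesis by simp
  next
    case (Suc x')
    show ?thesis
      unfolding Suc shelf_words_Suc
      by (intro finite_UN_I finite_imageI finite_atLeastAtMost \<open>\<And>x. finite (shelf_words D i x)\<close>)
  qed
qed

lemma card_shelf_words_Suc:
  "card (shelf_words D (Suc i) (Suc x)) =
     (\<Sum>y=1..(if odd (Suc x) \<longleftrightarrow> \<not> D i then Suc x else x). card (shelf_words D i y))"
proof -
  have inj: "inj_on (\<lambda>a. a(Suc i := Suc x)) (shelf_words D i y)" for y
  proof (rule inj_onI)
    fix a b assume "a \<in> shelf_words D i y" "b \<in> shelf_words D i y" and eq: "a(Suc i := Suc x) = b(Suc i := Suc x)"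
    then have "a (Suc i) = b (Suc i)"
      by (simp add: shelf_words_def)
    with eq show "a = b"
      by (metis fun_upd_triv fun_upd_upd)
  qed
  have disj: "(\<lambda>a. a(Suc i := Suc x)) ` shelf_words D i y \<inter> (\<lambda>a. a(Suc i := Suc x)) ` shelf_words D i z = {}"
    if "y \<noteq> z" for y z
  proof -
    have "a i = y" if "a \<in> (\<lambda>a. a(Suc i := Suc x)) ` shelf_words D i y" for a y
      using that by (auto simp: shelf_words_def)
    with \<open>y \<noteq> z\<close> show ?thesis by blast
  qed
  show ?thesis
    unfolding shelf_words_Suc
    by (subst card_UN_disjoint) (use disj in \<open>auto simp: finite_shelf_words card_image[OF inj]\<close>)
qed

text \<open>Cumulating over the last label turns the sum in \<open>card_shelf_words_Suc\<close> into
  a single earlier value, and \<open>x = 2 * m\<close> covers all labels of \<open>m\<close>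
  shelves.\<close>

definition word_count :: "(nat \<Rightarrow> bool) \<Rightarrow> nat \<Rightarrow> nat \<Rightarrow> nat" where
  "word_count D i x = (\<Sum>y=1..x. card (shelf_words D i y))"

lemma word_count_0 [simp]: "word_count D i 0 = 0"
  by (simp add: word_count_def)

lemma word_count_first: "word_count D 0 x = x"
  by (induction x) (auto simp: word_count_def shelf_words_0)

lemma word_count_Suc:
  "word_count D (Suc i) (Suc x) =
     word_count D (Suc i) x + word_count D i (if odd (Suc x) \<longleftrightarrow> \<not> D i then Suc x else x)"
  by (simp add: word_count_def card_shelf_words_Suc)

text \<open>Reading the labels along \<open>w\<close> is a bijection from labellings to words with
  last label at most \<open>2 * m\<close>; \<open>f\<close> and \<open>g\<close> are its two
  directions.\<close>

lemma card_shelf_labellings: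
  assumes w: "w permutes {1..Suc i}"
  shows "card {l \<in> PiE_dflt {1..Suc i} 0 (\<lambda>_. {1..2 * m}). shelf_perm (Suc i) m l = w} =
    word_count (descent w) i (2 * m)" (is "card ?L = _")
proof -
  let ?W = "\<Union>x\<in>{1..2 * m}. shelf_words (descent w) i x"
  let ?n = "Suc i"
  have inv: "inv w k \<in> {1..?n}" if "k \<in> {1..?n}" for k
    using permutes_in_image[OF permutes_inv[OF w]] that by blast
  \<comment> \<open>Membership in \<open>?W\<close> bounds only the last label; monotonicity carries
    the bound to the others.\<close>
  have le: "a j \<le> a i" if "j \<le> i" "a \<in> shelf_words D i x" for j a D x
  proof -
    have "a j \<le> a (Suc j)" if "j < i" for j
      using that \<open>a \<in> shelf_words D i x\<close> unfolding shelf_words_def label_step_def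
      by (auto dest!: spec[of _ j])
    with \<open>j \<le> i\<close> show ?thesis
      by (induction rule: inc_induct) (auto intro: order.trans)
  qed
  define f :: "(nat \<Rightarrow> nat) \<Rightarrow> nat \<Rightarrow> nat"
    where "f l j = (if j \<le> i then l (w (Suc j)) else 0)" for l j
  define g :: "(nat \<Rightarrow> nat) \<Rightarrow> nat \<Rightarrow> nat"
    where "g a k = (if k \<in> {1..?n} then a (inv w k - 1) else 0)" for a k
  have w_in: "w (Suc j) \<in> {1..?n}" if "j \<le> i" for j
    using permutes_in_image[OF w, of "Suc j"] that by simp
  have gw: "g a (w (Suc j)) = a j" if "j \<le> i" for a j
    using w_in[OF that] permutes_inverses(2)[OF w, of "Suc j"] by (simp add: g_def)
  have gf: "g (f l) = l" if "l \<in> ?L" for l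
  proof
    fix k
    show "g (f l) k = l k"
    proof (cases "k \<in> {1..?n}")
      case True
      then have "inv w k - 1 \<le> i" "Suc (inv w k - 1) = inv w k"
        using inv[OF True] by auto
      then show ?thesis
        using True permutes_inverses(1)[OF w, of k] by (simp add: f_def g_def)
    next
      case False
      then show ?thesis
        using that by (auto simp: g_def PiE_dflt_def)
    qed
  qed
  have fg: "f (g a) = a" if "a \<in> ?W" for a
  proof
    fix j
    show "f (g a) j = a j"
      using that by (cases "j \<le> i") (auto simp: f_def gw shelf_words_def)
  qed
  have f_in: "f l \<in> ?W" if l: "l \<in> ?L" for l
  proof -
    have range: "l (w (Suc j)) \<in> {1..2 * m}" if "j \<le> i" for j
      using l w_in[OF that] unfolding PiE_dflt_def by blast
    have "l \<in> {1..?n} \<rightarrow> {1..2 * m}"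
      using l unfolding PiE_dflt_def by blast
    then have "\<forall>j. Suc j < ?n \<longrightarrow> label_step (descent w j) (l (w (Suc j))) (l (w (Suc (Suc j))))"
      using shelf_perm_eq_iff[OF w] l by blast
    then have "f l \<in> shelf_words (descent w) i (l (w ?n))"
      using range by (auto simp: shelf_words_def f_def)
    then show ?thesis
      using range[of i] by blast
  qed
  have g_in: "g a \<in> ?L" if "a \<in> ?W" for a
  proof -
    obtain x where a: "a \<in> shelf_words (descent w) i x" and x: "x \<le> 2 * m"
      using \<open>a \<in> ?W\<close> by auto
    have "a i = x"
      using a by (simp add: shelf_words_def)
    have "a j \<in> {1..2 * m}" if "j \<le> i" for j
      using le[OF that a] a x that \<open>a i = x\<close> by (simp add: shelf_words_def)
    then have "g a k \<in> {1..2 * m}" if "k \<in> {1..?n}" for k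
      using that inv[OF that] by (auto simp: g_def)
    then have l: "g a \<in> PiE_dflt {1..?n} 0 (\<lambda>_. {1..2 * m})"
      and "g a \<in> {1..?n} \<rightarrow> {1..2 * m}"
      by (auto simp: PiE_dflt_def g_def)
    then have "shelf_perm ?n m (g a) = w"
      using shelf_perm_eq_iff[OF w] a by (auto simp: shelf_words_def gw)
    with l show ?thesis by blast
  qed
  have "bij_betw f ?L ?W"
    by (rule bij_betw_byWitness[where f' = g]) (use gf fg f_in g_in in blast)+
  then have "card ?L = card ?W"
    by (rule bij_betw_same_card)
  also have "\<dots> = word_count (descent w) i (2 * m)"
    unfolding word_count_def by (intro card_UN_disjoint) (auto simp: finite_shelf_words, auto simp: shelf_words_def)
  finally show ?thesis .
qed

section \<open>Generating functions\<close>

definition even_gf :: "(nat \<Rightarrow> bool) \<Rightarrow> nat \<Rightarrow> real fps" where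
  "even_gf D i = Abs_fps (\<lambda>s. real (word_count D i (2 * s)))"

text \<open>The recursion depends on the parity of the label, hence two series. At
  \<open>s = 0\<close> natural subtraction gives argument 0, so the constant coefficient is
  0.\<close>

definition odd_gf :: "(nat \<Rightarrow> bool) \<Rightarrow> nat \<Rightarrow> real fps" where
  "odd_gf D i = Abs_fps (\<lambda>s. real (word_count D i (2 * s - 1)))"

text \<open>Passing to label 2s+1 and then to 2s+2 adds the earlier count at 2s+1 both times: the
  odd label may repeat, the even one may not.\<close>

lemma gf_ascent:
  assumes "\<not> D i"
  shows "odd_gf D (Suc i) = fps_X * even_gf D (Suc i) + odd_gf D i"
    and "even_gf D (Suc i) = odd_gf D (Suc i) + odd_gf D i"
proof -
  have *: "word_count D (Suc i) (Suc (2 * s)) = word_count D (Suc i) (2 * s) + word_count D i (Suc (2 * s))"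
    "word_count D (Suc i) (Suc (Suc (2 * s))) = word_count D (Suc i) (Suc (2 * s)) + word_count D i (Suc (2 * s))" for s
    using assms by (simp_all add: word_count_Suc[of D i])
  show "odd_gf D (Suc i) = fps_X * even_gf D (Suc i) + odd_gf D i"
    "even_gf D (Suc i) = odd_gf D (Suc i) + odd_gf D i"
  proof (rule_tac [!] fps_ext)
    fix s
    show "fps_nth (odd_gf D (Suc i)) s = fps_nth (fps_X * even_gf D (Suc i) + odd_gf D i) s"
      by (cases s) (simp_all add: odd_gf_def even_gf_def *)
    show "fps_nth (even_gf D (Suc i)) s = fps_nth (odd_gf D (Suc i) + odd_gf D i) s"
      by (cases s) (simp_all add: odd_gf_def even_gf_def *)
  qed
qed

text \<open>Only even labels may repeat here, so the two increments are the earlier counts at 2s and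
  at 2s+2.\<close>

lemma gf_descent:
  assumes "D i"
  shows "odd_gf D (Suc i) = fps_X * even_gf D (Suc i) + fps_X * even_gf D i"
    and "even_gf D (Suc i) = odd_gf D (Suc i) + even_gf D i"
proof -
  have *: "word_count D (Suc i) (Suc (2 * s)) = word_count D (Suc i) (2 * s) + word_count D i (2 * s)"
    "word_count D (Suc i) (Suc (Suc (2 * s))) = word_count D (Suc i) (Suc (2 * s)) + word_count D i (Suc (Suc (2 * s)))" for s
    using assms by (simp_all add: word_count_Suc[of D i])
  show "odd_gf D (Suc i) = fps_X * even_gf D (Suc i) + fps_X * even_gf D i"
    "even_gf D (Suc i) = odd_gf D (Suc i) + even_gf D i"
  proof (rule_tac [!] fps_ext)
    fix s
    show "fps_nth (odd_gf D (Suc i)) s = fps_nth (fps_X * even_gf D (Suc i) + fps_X * even_gf D i) s"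
      by (cases s) (simp_all add: odd_gf_def even_gf_def *)
    show "fps_nth (even_gf D (Suc i)) s = fps_nth (odd_gf D (Suc i) + even_gf D i) s"
      by (cases s) (simp_all add: odd_gf_def even_gf_def *)
  qed
qed

text \<open>The coefficients are 2s and 2s-1, so the series are 2t/(1-t)^2 and t(1+t)/(1-t)^2,
  stated here without division.\<close>

lemma gf_first:
  "(1 - fps_X)\<^sup>2 * even_gf D 0 = 2 * fps_X" "(1 + fps_X) * even_gf D 0 = 2 * odd_gf D 0"
proof -
  \<comment> \<open>This is t/(1-t), given by a linear equation so that it can be eliminated
    algebraically.\<close>
  define T :: "real fps" where "T = Abs_fps (\<lambda>s. if s = 0 then 0 else 1)"
  have T: "T = fps_X * T + fps_X"
  proof (rule fps_ext)
    fix s show "fps_nth T s = fps_nth (fps_X * T + fps_X) s"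
      by (cases s) (simp_all add: T_def)
  qed
  have U: "even_gf D 0 = fps_X * even_gf D 0 + 2 * T"
  proof (rule fps_ext)
    fix s show "fps_nth (even_gf D 0) s = fps_nth (fps_X * even_gf D 0 + 2 * T) s"
      by (cases s) (simp_all add: T_def even_gf_def word_count_first fps_numeral_fps_const)
  qed
  have V: "odd_gf D 0 = fps_X * even_gf D 0 + T"
  proof (rule fps_ext)
    fix s show "fps_nth (odd_gf D 0) s = fps_nth (fps_X * even_gf D 0 + T) s"
      by (cases s) (simp_all add: T_def even_gf_def odd_gf_def word_count_first)
  qed
  show "(1 - fps_X)\<^sup>2 * even_gf D 0 = 2 * fps_X"
    using T U by algebra
  show "(1 + fps_X) * even_gf D 0 = 2 * odd_gf D 0"
    using T U V by algebra
qed

definition valleys :: "(nat \<Rightarrow> bool) \<Rightarrow> nat \<Rightarrow> nat" where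
  "valleys D i = card {j. Suc j < i \<and> D j \<and> \<not> D (Suc j)}"

lemma valleys_0: "valleys D 0 = 0"
  by (simp add: valleys_def)

lemma valleys_Suc:
  "valleys D (Suc i) = valleys D i + (if i > 0 \<and> D (i - 1) \<and> \<not> D i then 1 else 0)"
proof -
  have fin: "finite {j. Suc j < i \<and> D j \<and> \<not> D (Suc j)}"
    by (rule finite_subset[of _ "{..<i}"]) auto
  show ?thesis
  proof (cases "i > 0 \<and> D (i - 1) \<and> \<not> D i")
    case True
    then have "{j. Suc j < Suc i \<and> D j \<and> \<not> D (Suc j)} =
        insert (i - 1) {j. Suc j < i \<and> D j \<and> \<not> D (Suc j)}"
      by (auto simp: less_Suc_eq)
    with True fin show ?thesis
      by (simp add: valleys_def)
  next
    case False
    then have "{j. Suc j < Suc i \<and> D j \<and> \<not> D (Suc j)} =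
        {j. Suc j < i \<and> D j \<and> \<not> D (Suc j)}"
      by (auto simp: less_Suc_eq)
    with False show ?thesis
      by (auto simp: valleys_def)
  qed
qed

text \<open>Each step multiplies \<open>even_gf\<close> by \<open>(1 + t) / (1 - t)\<close>, except that an ascent after a descent
  multiplies it by \<open>4 t / ((1 - t) (1 + t))\<close>. The linear relation between \<open>even_gf\<close> and \<open>odd_gf\<close>
  records the direction of the last step and makes the induction close.\<close>

lemma even_gf_invariant:
  "(1 - fps_X) ^ (i + 2) * even_gf D i =
     2 * 4 ^ valleys D i * fps_X ^ Suc (valleys D i) * (1 + fps_X) ^ (i - 2 * valleys D i) \<and>
   (if i > 0 \<and> D (i - 1)
    then 2 * valleys D i < i \<and> (1 + fps_X) * odd_gf D i = 2 * fps_X * even_gf D i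
    else 2 * valleys D i \<le> i \<and> (1 + fps_X) * even_gf D i = 2 * odd_gf D i)"
proof (induction i)
  case 0
  then show ?case
    using gf_first[of D] by (simp add: valleys_0 power2_eq_square)
next
  case (Suc i)
  let ?v = "valleys D i"
  let ?U = "even_gf D i" and ?U' = "even_gf D (Suc i)"
  let ?V = "odd_gf D i" and ?V' = "odd_gf D (Suc i)"
  define P where "P = (1 - fps_X :: real fps) ^ (i + 2)"
  define Q where "Q = 2 * 4 ^ ?v * fps_X ^ Suc ?v * (1 + fps_X :: real fps) ^ (i - 2 * ?v)"
  have PQ: "P * ?U = Q"
    using Suc.IH by (simp add: P_def Q_def)
  have le: "2 * ?v \<le> i"
    using Suc.IH by (auto split: if_splits)
  have P': "(1 - fps_X) ^ (Suc i + 2) = (1 - fps_X) * P"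
    by (simp add: P_def)
  have Q': "2 * 4 ^ ?v * fps_X ^ Suc ?v * (1 + fps_X :: real fps) ^ (Suc i - 2 * ?v) = (1 + fps_X) * Q"
    using le by (simp add: Q_def Suc_diff_le)
  \<comment> \<open>The direction of the preceding step matters only for an ascent.\<close>
  consider (desc) "D i" | (valley) "\<not> D i" "i > 0 \<and> D (i - 1)" | (asc) "\<not> D i" "\<not> (i > 0 \<and> D (i - 1))"
    by blast
  then show ?case
  proof cases
    case desc
    have v': "valleys D (Suc i) = ?v"
      using desc by (simp add: valleys_Suc)
    have "(1 - fps_X) * P * ?U' = (1 + fps_X) * Q"
      using gf_descent[of D, OF desc] PQ by algebra
    moreover have "(1 + fps_X) * ?V' = 2 * fps_X * ?U'"
      using gf_descent[of D, OF desc] by algebra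
    ultimately show ?thesis
      unfolding P' v' Q' using desc le by simp
  next
    case asc
    have v': "valleys D (Suc i) = ?v"
      using asc by (auto simp: valleys_Suc)
    have V: "(1 + fps_X) * ?U = 2 * ?V"
      using Suc.IH asc by (auto split: if_splits)
    have "(1 - fps_X) * P * ?U' = (1 + fps_X) * Q"
      using gf_ascent[of D, OF asc(1)] PQ V by algebra
    moreover have "(1 + fps_X) * ?U' = 2 * ?V'"
      using gf_ascent[of D, OF asc(1)] by algebra
    ultimately show ?thesis
      unfolding P' v' Q' using asc le by simp
  next
    case valley
    have v': "valleys D (Suc i) = Suc ?v"
      using valley by (simp add: valleys_Suc)
    have V: "(1 + fps_X) * ?V = 2 * fps_X * ?U" and less: "2 * ?v < i"
      using Suc.IH valley by (auto split: if_splits)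
    \<comment> \<open>The preceding descent makes \<open>2 * ?v < i\<close> strict, so
      \<open>Q\<close> contains a factor 1+t to split off.\<close>
    define Q1 where "Q1 = 2 * 4 ^ ?v * fps_X ^ Suc ?v * (1 + fps_X :: real fps) ^ (i - 2 * ?v - 1)"
    have Q1: "Q = (1 + fps_X) * Q1"
      using power_minus_mult[of "i - 2 * ?v" "1 + fps_X :: real fps"] less
      by (simp add: Q_def Q1_def mult_ac)
    have nz: "(1 + fps_X :: real fps) \<noteq> 0"
    proof
      assume "(1 + fps_X :: real fps) = 0"
      then have "fps_nth (1 + fps_X :: real fps) 0 = fps_nth 0 0" by simp
      then show False by simp
    qed
    \<comment> \<open>The relations give the valley step only up to a factor 1+t, which cancels
      because power series have no zero divisors.\<close>
    have "(1 + fps_X) * ((1 - fps_X) * P * ?U') = (1 + fps_X) * (4 * fps_X * Q1)"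
      using gf_ascent[of D, OF valley(1)] PQ V Q1 by algebra
    then have *: "(1 - fps_X) * P * ?U' = 4 * fps_X * Q1"
      using nz by (simp only: mult_cancel_left) simp
    have "2 * 4 ^ Suc ?v * fps_X ^ Suc (Suc ?v) * (1 + fps_X :: real fps) ^ (Suc i - 2 * Suc ?v) =
        4 * fps_X * Q1"
      by (simp add: Q1_def)
    moreover have "(1 + fps_X) * ?U' = 2 * ?V'"
      using gf_ascent[of D, OF valley(1)] by algebra
    ultimately show ?thesis
      unfolding P' v' * using valley less by simp
  qed
qed

section \<open>Extraction of coefficients and the law of the shuffle\<close>

lemma two_valleys_le: "2 * valleys D i \<le> i"
  using even_gf_invariant[of i D] by (auto split: if_splits)

lemma fps_nth_one_plus_X_power: "fps_nth ((1 + fps_X) ^ k :: real fps) a = real (k choose a)"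
  by (simp add: fps_binomial_of_nat[symmetric] binomial_gbinomial)

text \<open>The index \<open>a\<close> is the power of t taken from (1+t)^k with k = i - 2v; the
  conditional supplies 0 for coefficients of negative index.\<close>

lemma word_count_valleys:
  fixes D i
  defines "v \<equiv> valleys D i"
  shows "real (word_count D i (2 * m)) = 2 * 4 ^ v * (\<Sum>a\<le>i - 2 * v.
     real ((i - 2 * v) choose a) *
     (if Suc (v + a) \<le> m then real ((m - Suc (v + a) + Suc i) choose Suc i) else 0))"
proof -
  let ?k = "i - 2 * v"
  \<comment> \<open>The negative binomial series of 1/(1-t)^(i+2).\<close>
  define B :: "real fps" where "B = Abs_fps (\<lambda>s. real ((s + Suc i) choose Suc i))"
  have "inverse ((1 - fps_X) ^ (i + 2) :: real fps) = B"
    using one_minus_const_fps_X_neg_power'[of "i + 2" "1::real"]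
    by (simp add: B_def binomial_symmetric[of "Suc i"] add.commute)
       (subst binomial_symmetric, simp_all add: add.commute)
  moreover have "((1 - fps_X) ^ (i + 2) :: real fps) * inverse ((1 - fps_X) ^ (i + 2)) = 1"
    by (subst mult.commute, rule inverse_mult_eq_1) simp
  ultimately have "even_gf D i = (1 - fps_X) ^ (i + 2) * even_gf D i * B"
    by (simp add: mult_ac)
  also have "\<dots> = 2 * 4 ^ v * fps_X ^ Suc v * (1 + fps_X) ^ ?k * B"
    using even_gf_invariant[of i D] by (simp add: v_def)
  also have "\<dots> = fps_const (2 * 4 ^ v) * (fps_X ^ Suc v * ((1 + fps_X) ^ ?k * B))"
    by (simp add: fps_numeral_fps_const fps_const_power mult_ac)
  finally have "fps_nth (even_gf D i) m = 2 * 4 ^ v * fps_nth (fps_X ^ Suc v * ((1 + fps_X) ^ ?k * B)) m"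
    by simp
  also have "fps_nth (fps_X ^ Suc v * ((1 + fps_X) ^ ?k * B)) m =
     (\<Sum>a\<le>?k. real (?k choose a) *
     (if Suc (v + a) \<le> m then real ((m - Suc (v + a) + Suc i) choose Suc i) else 0))"
  proof (cases "m < Suc v")
    case True
    then show ?thesis by (simp add: fps_X_power_mult_nth del: power_Suc)
  next
    case False
    then have "fps_nth (fps_X ^ Suc v * ((1 + fps_X) ^ ?k * B)) m =
        (\<Sum>a=0..m - Suc v. real (?k choose a) * real ((m - Suc v - a + Suc i) choose Suc i))"
      unfolding fps_X_power_mult_nth by (simp add: fps_mult_nth fps_nth_one_plus_X_power B_def)
    also have "\<dots> = (\<Sum>a\<in>{..?k} \<inter> {..m - Suc v}.
        real (?k choose a) * real ((m - Suc v - a + Suc i) choose Suc i))"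
      by (rule sum.mono_neutral_right) (auto simp: not_le)
    also have "\<dots> = (\<Sum>a\<in>{..?k} \<inter> {..m - Suc v}. real (?k choose a) *
       (if Suc (v + a) \<le> m then real ((m - Suc (v + a) + Suc i) choose Suc i) else 0))"
      using False by (intro sum.cong) auto
    also have "\<dots> = (\<Sum>a\<le>?k. real (?k choose a) *
       (if Suc (v + a) \<le> m then real ((m - Suc (v + a) + Suc i) choose Suc i) else 0))"
      using False by (intro sum.mono_neutral_left) auto
    finally show ?thesis .
  qed
  finally show ?thesis
    by (simp add: even_gf_def)
qed

text \<open>A product of uniform label laws is uniform on labellings, so the probability is a
  quotient of two counts.\<close>

lemma pmf_shelf_shuffle:
  assumes w: "w permutes {1..Suc i}" and m: "m > 0"
  shows "pmf (shelf_shuffle_pmf (Suc i) m) w = word_count (descent w) i (2 * m) / (2 * real m) ^ Suc i"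
proof -
  let ?A = "PiE_dflt {1..Suc i} (0 :: nat) (\<lambda>_. {1..2 * m})"
  have card: "card ?A = (2 * m) ^ Suc i"
    by (subst card_PiE_dflt) auto
  have fin: "finite ?A"
    by (intro finite_PiE_dflt) auto
  have ne: "?A \<noteq> {}"
    using card m by (metis card.empty nat_0_less_mult_iff pos2 power_eq_0_iff less_numeral_extra(3))
  have "?A \<inter> shelf_perm (Suc i) m -` {w} = {l \<in> ?A. shelf_perm (Suc i) m l = w}"
    by auto
  then have num: "card (?A \<inter> shelf_perm (Suc i) m -` {w}) = word_count (descent w) i (2 * m)"
    using card_shelf_labellings[OF w, of m] by simp
  have "shelf_shuffle_pmf (Suc i) m = map_pmf (shelf_perm (Suc i) m) (pmf_of_set ?A)"
    unfolding shelf_shuffle_pmf_def by (subst Pi_pmf_of_set) (use m in auto)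
  then show ?thesis
    by (simp only: pmf_map measure_pmf_of_set[OF ne fin] num card) simp
qed

section \<open>The likelihood ratio\<close>

text \<open>The expectation of \<open>\<Prod>j (1 + (x\<^sub>j - \<delta>) / M)\<close> with \<open>x\<^sub>j = j - (n + 1) / 2\<close> and \<open>\<delta>\<close> a centred
  binomial variable with \<open>k\<close> fair trials.\<close>

definition shelf_ratio :: "nat \<Rightarrow> nat \<Rightarrow> real \<Rightarrow> real" where
  "shelf_ratio n k M = (\<Sum>a\<le>k. real (k choose a) / 2 ^ k *
     (\<Prod>j=1..n. 1 + (real j - (real n + 1) / 2 - (real a - real k / 2)) / M))"

lemma fact_binomial_prod: "fact n * real ((N + n) choose n) = (\<Prod>j=1..n. real N + real j)"
proof -
  have *: "fact (N + n) = fact N * (\<Prod>j=1..n. real N + real j)"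
  proof (induction n)
    case (Suc n)
    have "fact (N + Suc n) = (real N + real (Suc n)) * fact (N + n)"
      by simp
    also have "\<dots> = fact N * (\<Prod>j=1..Suc n. real N + real j)"
      unfolding Suc.IH by (simp add: mult_ac)
    finally show ?case .
  qed simp
  have "real (fact n * fact N * ((N + n) choose n)) = real (fact (N + n))"
    using binomial_fact_lemma[of n "N + n"] by simp
  then have "fact n * fact N * real ((N + n) choose n) = fact (N + n)"
    by (simp only: of_nat_mult of_nat_fact)
  with * have "fact N * (fact n * real ((N + n) choose n)) = fact N * (\<Prod>j=1..n. real N + real j)"
    by (simp only: mult_ac)
  then show ?thesis
    by (simp only: mult_cancel_left fact_nonzero) simp
qed

text \<open>With n = 2v+k+1 the centring (n+1)/2 - k/2 equals v+1, so the factors in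
  \<open>shelf_ratio\<close> are exactly (m-(v+1+a)+j)/m.\<close>

lemma pmf_shelf_shuffle_div_uniform:
  assumes w: "w permutes {1..Suc i}" and m: "m > 0"
  shows "pmf (shelf_shuffle_pmf (Suc i) m) w / pmf (uniform_perm_pmf (Suc i)) w =
    shelf_ratio (Suc i) (i - 2 * valleys (descent w) i) (real m)"
proof -
  define v where "v = valleys (descent w) i"
  define k where "k = i - 2 * v"
  let ?n = "Suc i"
  have i: "i = 2 * v + k"
    using two_valleys_le[of "descent w" i] by (simp add: k_def v_def)
  have "card (sym_group ?n) = fact ?n" "finite (sym_group ?n)"
    unfolding sym_group_def by (auto simp: card_permutations finite_permutations)
  moreover have "w \<in> sym_group ?n"
    using w by (simp add: sym_group_def)
  ultimately have unif: "pmf (uniform_perm_pmf ?n) w = 1 / fact ?n"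
    unfolding uniform_perm_pmf_def by (subst pmf_of_set) (auto simp del: fact_Suc)
  have summand: "fact ?n * (if Suc (v + a) \<le> m then real ((m - Suc (v + a) + ?n) choose ?n) else 0) / real m ^ ?n
      = (\<Prod>j=1..?n. 1 + (real j - (real ?n + 1) / 2 - (real a - real k / 2)) / real m)"
    if a: "a \<le> k" for a
  proof -
    have factor: "1 + (real j - (real ?n + 1) / 2 - (real a - real k / 2)) / real m =
        (real m - real (Suc (v + a)) + real j) / real m" for j
      using m by (simp add: field_simps i)
    show ?thesis
    proof (cases "Suc (v + a) \<le> m")
      case True
      then show ?thesis
        unfolding factor using fact_binomial_prod[of ?n "m - Suc (v + a)"]
        by (simp add: prod_dividef of_nat_diff del: prod.cl_ivl_Suc fact_Suc power_Suc)
    next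
      case False
      \<comment> \<open>The factor at j = v+1+a-m vanishes; this index lies in
        \<open>{1..?n}\<close> as \<open>a\<close> is at most \<open>k\<close>. It matches the 0 in
        the count.\<close>
      have "(\<Prod>j=1..?n. (real m - real (Suc (v + a)) + real j) / real m) = 0"
        by (rule prod_zero) (use False a i in \<open>auto intro!: bexI[of _ "Suc (v + a) - m"]\<close>)
      with False show ?thesis
        unfolding factor by simp
    qed
  qed
  \<comment> \<open>The factor 2 * 4^v of the count cancels against 2^n, leaving the 2^k that
    normalises the binomial weights.\<close>
  have pow: "2 * 4 ^ v * 2 ^ k = (2 :: real) ^ ?n"
    by (simp add: i power_add power_mult)
  have "pmf (shelf_shuffle_pmf ?n m) w / pmf (uniform_perm_pmf ?n) w =
      fact ?n * (2 * 4 ^ v * (\<Sum>a\<le>k. real (k choose a) *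
      (if Suc (v + a) \<le> m then real ((m - Suc (v + a) + ?n) choose ?n) else 0))) / (2 * real m) ^ ?n"
    unfolding pmf_shelf_shuffle[OF w m] unif word_count_valleys v_def[symmetric] k_def[symmetric]
    by (simp del: fact_Suc power_Suc)
  also have "\<dots> = (\<Sum>a\<le>k. real (k choose a) / 2 ^ k * (fact ?n *
      (if Suc (v + a) \<le> m then real ((m - Suc (v + a) + ?n) choose ?n) else 0) / real m ^ ?n))"
    unfolding power_mult_distrib pow[symmetric] sum_distrib_left sum_divide_distrib
    by (intro sum.cong refl) (simp add: field_simps del: fact_Suc power_Suc binomial_Suc_Suc)
  also have "\<dots> = shelf_ratio ?n k (real m)"
    unfolding shelf_ratio_def by (intro sum.cong refl arg_cong2[where f = "(*)"] summand) auto
  finally show ?thesis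
    by (simp add: k_def v_def)
qed

section \<open>Permutations with the fewest and the most valleys\<close>

lemma valleys_id: "valleys (descent id) i = 0"
  by (simp add: valleys_def descent_def)

text \<open>The permutation 2 1 4 3 6 5 \<open>\<dots>\<close>, which has as many valleys as possible.\<close>

definition zigzag :: "nat \<Rightarrow> nat \<Rightarrow> nat" where
  "zigzag n j = (if odd j \<and> j < n then Suc j else if even j \<and> 0 < j \<and> j \<le> n then j - 1 else j)"

lemma zigzag_permutes: "zigzag n permutes {1..n}"
proof -
  \<comment> \<open>An involution is bijective.\<close>
  have "zigzag n (zigzag n j) = j" for j
    by (cases "even j") (auto simp: zigzag_def)
  then have "\<exists>!x. zigzag n x = y" for y
    by metis
  then show ?thesis
    by (simp add: permutes_def zigzag_def)
qed

text \<open>Even steps descend and odd steps ascend, which gives \<open>i div 2\<close> valleys and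
  remainder \<open>i mod 2\<close>.\<close>

lemma valleys_zigzag: "i - 2 * valleys (descent (zigzag (Suc i))) i \<le> 1"
proof -
  have "descent (zigzag (Suc i)) j \<longleftrightarrow> even j \<and> j < i" if "j < i" for j
    using that by (auto simp: descent_def zigzag_def)
  then have "{j. Suc j < i \<and> descent (zigzag (Suc i)) j \<and> \<not> descent (zigzag (Suc i)) (Suc j)} =
      (\<lambda>r. 2 * r) ` {..<i div 2}"
    by (auto elim!: evenE)
  then have "valleys (descent (zigzag (Suc i))) i = i div 2"
    by (simp add: valleys_def card_image inj_on_def)
  then show ?thesis
    by simp
qed

section \<open>Bounds for the likelihood ratio\<close>

text \<open>The difference has derivative t^2/(1+t), at most 2y^2 between 0 and y; the mean value
  bound gives the cube.\<close>

lemma abs_ln_one_plus_le: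
  fixes y :: real
  assumes "\<bar>y\<bar> \<le> 1 / 2"
  shows "\<bar>ln (1 + y) - (y - y\<^sup>2 / 2)\<bar> \<le> 2 * \<bar>y\<bar> ^ 3"
proof -
  define g where "g t = ln (1 + t) - (t - t\<^sup>2 / 2)" for t :: real
  have "norm (g y - g 0) \<le> 2 * y\<^sup>2 * norm (y - 0)"
  proof (rule field_differentiable_bound[of "closed_segment 0 y" g "\<lambda>t. t\<^sup>2 / (1 + t)"])
    fix t assume "t \<in> closed_segment 0 y"
    then have t: "\<bar>t\<bar> \<le> \<bar>y\<bar>" "\<bar>t\<bar> \<le> 1 / 2"
      using assms by (auto simp: closed_segment_eq_real_ivl split: if_splits)
    have "(g has_field_derivative 1 / (1 + t) - (1 - t)) (at t within closed_segment 0 y)"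
      unfolding g_def by (rule derivative_eq_intros refl | use t in force)+
    moreover have "1 / (1 + t) - (1 - t) = t\<^sup>2 / (1 + t)"
      using t by (simp add: field_simps power2_eq_square)
    ultimately show "(g has_field_derivative t\<^sup>2 / (1 + t)) (at t within closed_segment 0 y)"
      by simp
    have "t\<^sup>2 / (1 + t) \<le> y\<^sup>2 / (1 / 2)"
      using t by (intro frac_le) (auto simp: abs_le_square_iff)
    then show "norm (t\<^sup>2 / (1 + t)) \<le> 2 * y\<^sup>2"
      using t by simp
  qed auto
  then show ?thesis
    by (simp add: g_def power3_eq_cube power2_eq_square abs_mult[symmetric] mult.assoc)
qed

lemma prod_one_plus_bounds:
  fixes y :: "'a \<Rightarrow> real"
  assumes y: "\<And>j. j \<in> A \<Longrightarrow> \<bar>y j\<bar> \<le> \<theta>" and \<theta>: "\<theta> \<le> 1 / 2"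
  defines "S \<equiv> (\<Sum>j\<in>A. y j) - (\<Sum>j\<in>A. (y j)\<^sup>2) / 2" and "E \<equiv> 2 * real (card A) * \<theta> ^ 3"
  shows "exp (S - E) \<le> (\<Prod>j\<in>A. 1 + y j)" "(\<Prod>j\<in>A. 1 + y j) \<le> exp (S + E)"
proof -
  have bound: "\<bar>ln (1 + y j) - (y j - (y j)\<^sup>2 / 2)\<bar> \<le> 2 * \<theta> ^ 3" and pos: "1 + y j > 0" if "j \<in> A" for j
  proof -
    have "2 * \<bar>y j\<bar> ^ 3 \<le> 2 * \<theta> ^ 3"
      using y[OF that] by (intro mult_left_mono power_mono) auto
    then show "\<bar>ln (1 + y j) - (y j - (y j)\<^sup>2 / 2)\<bar> \<le> 2 * \<theta> ^ 3"
      using abs_ln_one_plus_le[of "y j"] y[OF that] \<theta> by linarith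
    show "1 + y j > 0"
      using y[OF that] \<theta> by linarith
  qed
  have S: "S = (\<Sum>j\<in>A. y j - (y j)\<^sup>2 / 2)"
    by (simp add: S_def sum_subtractf sum_divide_distrib)
  have E: "E = (\<Sum>j\<in>A. 2 * \<theta> ^ 3)"
    by (simp add: E_def)
  have prod: "(\<Prod>j\<in>A. 1 + y j) = exp (\<Sum>j\<in>A. ln (1 + y j))" if "finite A"
    using pos that by (simp add: exp_sum)
  have "(\<Sum>j\<in>A. y j - (y j)\<^sup>2 / 2 - 2 * \<theta> ^ 3) \<le> (\<Sum>j\<in>A. ln (1 + y j))"
    using bound by (intro sum_mono) (auto simp: abs_le_iff algebra_simps)
  moreover have "(\<Sum>j\<in>A. ln (1 + y j)) \<le> (\<Sum>j\<in>A. y j - (y j)\<^sup>2 / 2 + 2 * \<theta> ^ 3)"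
    using bound by (intro sum_mono) (auto simp: abs_le_iff algebra_simps)
  ultimately have "S - E \<le> (\<Sum>j\<in>A. ln (1 + y j))" "(\<Sum>j\<in>A. ln (1 + y j)) \<le> S + E"
    unfolding S E by (simp_all only: sum_subtractf sum.distrib)
  then show "exp (S - E) \<le> (\<Prod>j\<in>A. 1 + y j)" "(\<Prod>j\<in>A. 1 + y j) \<le> exp (S + E)"
    \<comment> \<open>For infinite \<open>A\<close> the sums and \<open>card\<close> default to 0
      and the product to 1, so both bounds read 1 \<le> 1.\<close>
    by (cases "finite A"; simp add: prod S_def E_def)+
qed

lemma sum_centred:
  fixes d :: real
  shows "(\<Sum>j=1..n. real j - (real n + 1) / 2 - d) = - real n * d"
    and "(\<Sum>j=1..n. (real j - (real n + 1) / 2 - d)\<^sup>2) = real n * ((real n)\<^sup>2 - 1) / 12 + real n * d\<^sup>2"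
proof -
  \<comment> \<open>The shift \<open>c\<close> stays free, since the centre (n+1)/2 would change
    along the induction.\<close>
  have 1: "(\<Sum>j=1..n. real j - c) = real n * (real n + 1) / 2 - real n * c" for c
    by (induction n) (simp_all add: field_simps)
  show "(\<Sum>j=1..n. real j - (real n + 1) / 2 - d) = - real n * d"
    using 1[of "(real n + 1) / 2 + d"] by (simp add: algebra_simps)
  have 2: "(\<Sum>j=1..n. (real j - c)\<^sup>2) =
      real n * (real n + 1) * (2 * real n + 1) / 6 - c * real n * (real n + 1) + real n * c\<^sup>2" for c
    by (induction n) (simp_all add: field_simps power2_eq_square)
  have "(\<Sum>j=1..n. (real j - (real n + 1) / 2 - d)\<^sup>2) = (\<Sum>j=1..n. (real j - ((real n + 1) / 2 + d))\<^sup>2)"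
    by (simp add: algebra_simps)
  then show "(\<Sum>j=1..n. (real j - (real n + 1) / 2 - d)\<^sup>2) = real n * ((real n)\<^sup>2 - 1) / 12 + real n * d\<^sup>2"
    unfolding 2 by (simp add: field_simps power2_eq_square)
qed

text \<open>The moment generating function of a centred Bin(k, 1/2) variable, by the binomial
  theorem.\<close>

lemma centred_binomial_exp:
  fixes s :: real
  shows "(\<Sum>a\<le>k. real (k choose a) / 2 ^ k * exp (s * (real a - real k / 2))) = cosh (s / 2) ^ k"
proof -
  have "cosh (s / 2) ^ k = (exp (s / 2) + exp (- (s / 2))) ^ k / 2 ^ k"
    by (simp add: cosh_def power_divide field_simps)
  also have "(exp (s / 2) + exp (- (s / 2))) ^ k =
      (\<Sum>a\<le>k. real (k choose a) * exp (s / 2) ^ a * exp (- (s / 2)) ^ (k - a))"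
    by (rule binomial_ring)
  also have "\<dots> = (\<Sum>a\<le>k. real (k choose a) * exp (s * (real a - real k / 2)))"
  proof (rule sum.cong[OF refl])
    fix a assume "a \<in> {..k}"
    then have "exp (s / 2) ^ a * exp (- (s / 2)) ^ (k - a) = exp (s * (real a - real k / 2))"
      by (simp add: of_nat_diff field_simps flip: exp_of_nat_mult exp_add)
    then show "real (k choose a) * exp (s / 2) ^ a * exp (- (s / 2)) ^ (k - a) =
        real (k choose a) * exp (s * (real a - real k / 2))"
      by (simp only: mult.assoc)
  qed
  finally show ?thesis
    by (simp add: sum_divide_distrib)
qed

lemma square_le_exp:
  fixes y :: real
  shows "y\<^sup>2 \<le> 2 * (exp y + exp (- y))"
proof -
  have "\<bar>y\<bar>\<^sup>2 / 2 \<le> exp \<bar>y\<bar>"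
    using exp_lower_Taylor_quadratic[of "\<bar>y\<bar>"] by simp
  moreover have "exp \<bar>y\<bar> \<le> exp y + exp (- y)"
    by (simp add: abs_if)
  ultimately show ?thesis
    by simp
qed

text \<open>Here \<open>\<theta> = n / M\<close>. The second-order term in \<open>\<delta>\<close> is dropped in the upper bound; in the lower
  bound it costs at most the term divided by \<open>n\<close>, by \<open>y\<^sup>2 \<le> 2 (e\<^sup>y + e\<^sup>-\<^sup>y)\<close> with \<open>y = \<theta> \<delta>\<close>.\<close>

lemma shelf_ratio_bounds:
  fixes \<theta> :: real and n k :: nat
  assumes \<theta>: "0 < \<theta>" "\<theta> \<le> 1 / 2" and k: "k < n"
  defines "c0 \<equiv> \<theta>\<^sup>2 * ((real n)\<^sup>2 - 1) / (24 * real n)"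
  shows "shelf_ratio n k (real n / \<theta>) \<le> exp (2 * real n * \<theta> ^ 3 - c0) * cosh (\<theta> / 2) ^ k" (is ?upper)
    and "exp (- 2 * real n * \<theta> ^ 3 - c0) * (cosh (\<theta> / 2) ^ k - (1 + cosh \<theta> ^ k) / real n)
      \<le> shelf_ratio n k (real n / \<theta>)" (is ?lower)
proof -
  define \<delta> where "\<delta> a = real a - real k / 2" for a
  define p where "p a = real (k choose a) / 2 ^ k" for a
  define P where "P a = (\<Prod>j=1..n. 1 + (real j - (real n + 1) / 2 - \<delta> a) / (real n / \<theta>))" for a
  have ratio: "shelf_ratio n k (real n / \<theta>) = (\<Sum>a\<le>k. p a * P a)"
    by (simp add: shelf_ratio_def p_def P_def \<delta>_def)
  have p_nonneg: "p a \<ge> 0" for a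
    by (simp add: p_def)
  have mgf: "(\<Sum>a\<le>k. p a * exp (s * \<delta> a)) = cosh (s / 2) ^ k" for s
    using centred_binomial_exp[of k s] by (simp add: p_def \<delta>_def)
  have p_sum: "(\<Sum>a\<le>k. p a) = 1"
    using mgf[of 0] by simp
  have P: "exp (- \<theta> * \<delta> a - c0 - (\<theta> * \<delta> a)\<^sup>2 / (2 * real n) - 2 * real n * \<theta> ^ 3) \<le> P a"
    "P a \<le> exp (- \<theta> * \<delta> a - c0 - (\<theta> * \<delta> a)\<^sup>2 / (2 * real n) + 2 * real n * \<theta> ^ 3)"
    if a: "a \<le> k" for a
  proof -
    let ?y = "\<lambda>j. (real j - (real n + 1) / 2 - \<delta> a) / (real n / \<theta>)"
    have y: "\<bar>?y j\<bar> \<le> \<theta>" if j: "j \<in> {1..n}" for j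
    proof -
      have "\<bar>real j - (real n + 1) / 2\<bar> \<le> (real n - 1) / 2"
        using j by (auto simp: abs_le_iff field_simps)
      \<comment> \<open>From k < n: the modulus of \<open>\<delta> a\<close> is at most k/2.\<close>
      moreover have "\<bar>\<delta> a\<bar> \<le> (real n - 1) / 2"
      proof (rule abs_leI)
        show "\<delta> a \<le> (real n - 1) / 2" "- \<delta> a \<le> (real n - 1) / 2"
          using a k unfolding \<delta>_def by (simp_all add: field_simps)
      qed
      ultimately have "\<bar>real j - (real n + 1) / 2 - \<delta> a\<bar> \<le> (real n - 1) / 2 + (real n - 1) / 2"
        by (rule order_trans[OF abs_triangle_ineq4 add_mono])
      then have "\<bar>real j - (real n + 1) / 2 - \<delta> a\<bar> \<le> real n"
        by (rule order_trans) (simp add: field_simps)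
      then have "\<bar>real j - (real n + 1) / 2 - \<delta> a\<bar> / (real n / \<theta>) \<le> real n / (real n / \<theta>)"
        using \<theta> by (intro divide_right_mono) auto
      then show ?thesis
        using \<theta> k unfolding abs_divide by simp
    qed
    have 1: "(\<Sum>j=1..n. ?y j) = - \<theta> * \<delta> a"
      unfolding sum_divide_distrib[symmetric] sum_centred using k by simp
    \<comment> \<open>\<open>c0\<close> is half the sum of squares n(n^2-1)/12 of the centred
      positions, scaled by (\<theta>/n)^2.\<close>
    have 2: "(\<Sum>j=1..n. (?y j)\<^sup>2) / 2 = c0 + (\<theta> * \<delta> a)\<^sup>2 / (2 * real n)"
      unfolding power_divide sum_divide_distrib[symmetric] sum_centred c0_def
      using k \<theta> by (simp add: field_simps power2_eq_square)
    show "exp (- \<theta> * \<delta> a - c0 - (\<theta> * \<delta> a)\<^sup>2 / (2 * real n) - 2 * real n * \<theta> ^ 3) \<le> P a"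
      "P a \<le> exp (- \<theta> * \<delta> a - c0 - (\<theta> * \<delta> a)\<^sup>2 / (2 * real n) + 2 * real n * \<theta> ^ 3)"
      using prod_one_plus_bounds[of "{1..n}" ?y \<theta>, OF y \<theta>(2)]
      unfolding 1 2 P_def by (simp_all add: algebra_simps)
  qed
  show ?upper
  proof -
    have "p a * P a \<le> exp (2 * real n * \<theta> ^ 3 - c0) * (p a * exp (- \<theta> * \<delta> a))" if "a \<le> k" for a
    proof -
      have "P a \<le> exp (2 * real n * \<theta> ^ 3 - c0 + (- \<theta> * \<delta> a))"
        using P(2)[OF that] by (rule order_trans) simp
      then have "P a \<le> exp (2 * real n * \<theta> ^ 3 - c0) * exp (- \<theta> * \<delta> a)"
        by (simp only: exp_add)
      from mult_left_mono[OF this p_nonneg[of a]] show ?thesis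
        by (simp only: mult_ac)
    qed
    then have "(\<Sum>a\<le>k. p a * P a) \<le> (\<Sum>a\<le>k. exp (2 * real n * \<theta> ^ 3 - c0) * (p a * exp (- \<theta> * \<delta> a)))"
      by (intro sum_mono) auto
    also have "\<dots> = exp (2 * real n * \<theta> ^ 3 - c0) * cosh (\<theta> / 2) ^ k"
      unfolding sum_distrib_left[symmetric] mgf by simp
    finally show ?thesis
      unfolding ratio .
  qed
  show ?lower
  proof -
    let ?C = "exp (- 2 * real n * \<theta> ^ 3 - c0)"
    have "?C * (p a * exp (- \<theta> * \<delta> a) - (p a + p a * exp (- 2 * \<theta> * \<delta> a)) / real n) \<le> p a * P a"
      if "a \<le> k" for a
    proof -
      define y where "y = \<theta> * \<delta> a"
      \<comment> \<open>The weight e^(-y) turns the bound for y^2 into 1 + e^(-2y), whose binomial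
        average is 1 + cosh(\<theta>)^k.\<close>
      have "exp (- y) * y\<^sup>2 \<le> exp (- y) * (2 * (exp y + exp (- y)))"
        by (intro mult_left_mono square_le_exp) auto
      also have "\<dots> = 2 * (1 + exp (- 2 * y))"
        by (simp add: algebra_simps flip: exp_add)
      finally have "exp (- y) * y\<^sup>2 / 2 \<le> 1 + exp (- 2 * y)"
        by simp
      then have "exp (- y) * y\<^sup>2 / 2 / real n \<le> (1 + exp (- 2 * y)) / real n"
        by (rule divide_right_mono) simp
      then have "exp (- y) - (1 + exp (- 2 * y)) / real n \<le> exp (- y) * (1 - y\<^sup>2 / (2 * real n))"
        by (simp add: right_diff_distrib)
      also have "\<dots> \<le> exp (- y) * exp (- (y\<^sup>2 / (2 * real n)))"
        using exp_ge_add_one_self[of "- (y\<^sup>2 / (2 * real n))"] by (intro mult_left_mono) auto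
      finally have "?C * (exp (- y) - (1 + exp (- 2 * y)) / real n) \<le>
          ?C * (exp (- y) * exp (- (y\<^sup>2 / (2 * real n))))"
        by (intro mult_left_mono) auto
      also have "\<dots> = exp (- y - c0 - y\<^sup>2 / (2 * real n) - 2 * real n * \<theta> ^ 3)"
        by (simp add: algebra_simps flip: exp_add)
      also have "\<dots> \<le> P a"
        using P(1)[OF that] by (simp add: y_def)
      finally have "p a * (?C * (exp (- y) - (1 + exp (- 2 * y)) / real n)) \<le> p a * P a"
        by (intro mult_left_mono p_nonneg)
      then show ?thesis
        by (simp add: y_def algebra_simps add_divide_distrib)
    qed
    then have "(\<Sum>a\<le>k. ?C * (p a * exp (- \<theta> * \<delta> a) - (p a + p a * exp (- 2 * \<theta> * \<delta> a)) / real n))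
        \<le> (\<Sum>a\<le>k. p a * P a)"
      by (intro sum_mono) auto
    moreover have "(\<Sum>a\<le>k. ?C * (p a * exp (- \<theta> * \<delta> a) - (p a + p a * exp (- 2 * \<theta> * \<delta> a)) / real n))
        = ?C * (cosh (\<theta> / 2) ^ k - (1 + cosh \<theta> ^ k) / real n)"
      unfolding sum_distrib_left[symmetric] sum_subtractf sum_divide_distrib[symmetric] sum.distrib mgf p_sum
      by simp
    ultimately show ?thesis
      unfolding ratio by simp
  qed
qed

section \<open>The limit\<close>

text \<open>With x^2 = 1/(b^2 n), ln(cosh x) is x^2/2 to leading order, and n copies add up to 1/(2
  b^2).\<close>

lemma cosh_power_tendsto:
  fixes b :: real
  assumes "b > 0"
  shows "(\<lambda>n. cosh (1 / (b * sqrt (real n))) ^ n) \<longlonglongrightarrow> exp (1 / (2 * b\<^sup>2))"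
proof -
  have "(\<lambda>n. ((exp (1 / (b * sqrt (real n))) + exp (- (1 / (b * sqrt (real n))))) / 2) powr real n)
      \<longlonglongrightarrow> exp (1 / (2 * b\<^sup>2))"
    using assms by (real_asymp simp: power2_eq_square field_simps)
  moreover have "((exp x + exp (- x)) / 2) powr real n = cosh x ^ n" for x :: real and n
    by (simp add: cosh_field_def powr_realpow add_pos_pos)
  ultimately show ?thesis
    by simp
qed

lemma shelf_bounds_tendsto:
  fixes c :: real
  assumes c: "c > 0"
  defines "\<theta> \<equiv> \<lambda>n. 1 / (c * sqrt (real n))"
  shows "(\<lambda>n. 2 * real n * \<theta> n ^ 3) \<longlonglongrightarrow> 0"
    and "(\<lambda>n. (\<theta> n)\<^sup>2 * ((real n)\<^sup>2 - 1) / (24 * real n)) \<longlonglongrightarrow> 1 / (24 * c\<^sup>2)"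
    and "(\<lambda>n. cosh (\<theta> n / 2)) \<longlonglongrightarrow> 1"
  using c unfolding \<theta>_def cosh_field_def by (real_asymp simp: power2_eq_square field_simps)+

text \<open>\<open>lo\<close> and \<open>up\<close> bound all values, while \<open>lo'\<close> and
  \<open>up'\<close> certify that values near both ends occur. By \<open>lu\<close> the upper
  deviation decides the maximum of the absolute value.\<close>

lemma max_tendsto:
  fixes f :: "nat \<Rightarrow> 'a \<Rightarrow> real"
  assumes F: "F \<le> sequentially"
    and fin: "\<And>n. finite (S n)"
    and lim: "lo \<longlonglongrightarrow> l" "up \<longlonglongrightarrow> u" "lo' \<longlonglongrightarrow> u" "up' \<longlonglongrightarrow> l" and lu: "1 - l \<le> u - 1"
    and bounds: "\<forall>\<^sub>F n in F. (\<forall>w\<in>S n. lo n \<le> f n w \<and> f n w \<le> up n) \<and>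
      (\<exists>w\<in>S n. lo' n \<le> f n w) \<and> (\<exists>w\<in>S n. f n w \<le> up' n)"
  shows "((\<lambda>n. Max ((\<lambda>w. \<bar>1 - f n w\<bar>) ` S n)) \<longlongrightarrow> u - 1) F"
    and "((\<lambda>n. Max ((\<lambda>w. 1 - f n w) ` S n)) \<longlongrightarrow> 1 - l) F"
proof -
  note lim_F = lim[THEN tendsto_mono[OF F]]
  show "((\<lambda>n. Max ((\<lambda>w. \<bar>1 - f n w\<bar>) ` S n)) \<longlongrightarrow> u - 1) F"
  proof (rule tendsto_sandwich)
    show "((\<lambda>n. lo' n - 1) \<longlongrightarrow> u - 1) F"
      by (intro tendsto_intros lim_F)
    have "((\<lambda>n. max (1 - lo n) (up n - 1)) \<longlongrightarrow> max (1 - l) (u - 1)) F"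
      by (intro tendsto_intros lim_F)
    with lu show "((\<lambda>n. max (1 - lo n) (up n - 1)) \<longlongrightarrow> u - 1) F"
      by (simp add: max_absorb2)
    show "\<forall>\<^sub>F n in F. lo' n - 1 \<le> Max ((\<lambda>w. \<bar>1 - f n w\<bar>) ` S n)"
      using bounds
    proof eventually_elim
      case (elim n)
      then obtain w where w: "w \<in> S n" "lo' n \<le> f n w"
        by blast
      have "lo' n - 1 \<le> \<bar>1 - f n w\<bar>"
        using w by simp
      also have "\<dots> \<le> Max ((\<lambda>w. \<bar>1 - f n w\<bar>) ` S n)"
        using w fin by (intro Max_ge) auto
      finally show ?case .
    qed
    show "\<forall>\<^sub>F n in F. Max ((\<lambda>w. \<bar>1 - f n w\<bar>) ` S n) \<le> max (1 - lo n) (up n - 1)"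
      using bounds
    proof eventually_elim
      case (elim n)
      then show ?case
        using fin by (subst Max_le_iff) (auto simp: abs_le_iff le_max_iff_disj)
    qed
  qed
  show "((\<lambda>n. Max ((\<lambda>w. 1 - f n w) ` S n)) \<longlongrightarrow> 1 - l) F"
  proof (rule tendsto_sandwich)
    show "((\<lambda>n. 1 - up' n) \<longlongrightarrow> 1 - l) F" "((\<lambda>n. 1 - lo n) \<longlongrightarrow> 1 - l) F"
      by (intro tendsto_intros lim_F)+
    show "\<forall>\<^sub>F n in F. 1 - up' n \<le> Max ((\<lambda>w. 1 - f n w) ` S n)"
      using bounds
    proof eventually_elim
      case (elim n)
      then obtain w where w: "w \<in> S n" "f n w \<le> up' n"
        by blast
      have "1 - up' n \<le> 1 - f n w"
        using w by simp
      also have "\<dots> \<le> Max ((\<lambda>w. 1 - f n w) ` S n)"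
        using w fin by (intro Max_ge) auto
      finally show ?case .
    qed
    show "\<forall>\<^sub>F n in F. Max ((\<lambda>w. 1 - f n w) ` S n) \<le> 1 - lo n"
      using bounds
    proof eventually_elim
      case (elim n)
      then show ?case
        using fin by (subst Max_le_iff) auto
    qed
  qed
qed

text \<open>\<open>F\<close> lets n tend to infinity through those n at which \<open>m n\<close> is
  exactly c n^(3/2).\<close>

theorem theorem3p5:
  fixes c :: real and m :: "nat \<Rightarrow> nat"
  defines "F \<equiv> inf sequentially (principal {n. real (m n) = c * real n powr (3 / 2)})"
  assumes "c > 0"
  shows "(\<lambda>n. Max ((\<lambda>w. \<bar>1 - pmf (shelf_shuffle_pmf n (m n)) w / pmf (uniform_perm_pmf n) w\<bar>)
                     ` sym_group n))
           \<sim>[F] (\<lambda>_. exp (1 / (12 * c\<^sup>2)) - 1)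
       \<and> (\<lambda>n. Max ((\<lambda>w. 1 - pmf (shelf_shuffle_pmf n (m n)) w / pmf (uniform_perm_pmf n) w)
                     ` sym_group n))
           \<sim>[F] (\<lambda>_. 1 - exp (- 1 / (24 * c\<^sup>2)))"
proof -
  define \<theta> where "\<theta> n = 1 / (c * sqrt (real n))" for n
  define err where "err n = 2 * real n * \<theta> n ^ 3" for n
  define c0 where "c0 n = (\<theta> n)\<^sup>2 * ((real n)\<^sup>2 - 1) / (24 * real n)" for n
  define C where "C n = cosh (\<theta> n / 2) ^ n" for n
  define D where "D n = (1 + cosh (\<theta> n) ^ n) / real n" for n
  let ?f = "\<lambda>n w. pmf (shelf_shuffle_pmf n (m n)) w / pmf (uniform_perm_pmf n) w"
  let ?l = "exp (- 1 / (24 * c\<^sup>2))" and ?u = "exp (1 / (12 * c\<^sup>2))"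
  \<comment> \<open>\<open>?lo\<close> and \<open>?up\<close> hold for all k, using 1 \<le> cosh^k
    \<le> cosh^n. \<open>?lo'\<close> is the lower bound at k = n-1 (the identity),
    \<open>?up'\<close> the upper bound for k \<le> 1 (the zigzag).\<close>
  let ?lo = "\<lambda>n. exp (- err n - c0 n) * (1 - D n)"
  let ?up = "\<lambda>n. exp (err n - c0 n) * C n"
  let ?lo' = "\<lambda>n. exp (- err n - c0 n) * (C n / cosh (\<theta> n / 2) - D n)"
  let ?up' = "\<lambda>n. exp (err n - c0 n) * cosh (\<theta> n / 2)"
  have err: "err \<longlonglongrightarrow> 0" and c0: "c0 \<longlonglongrightarrow> 1 / (24 * c\<^sup>2)"
    and cosh1: "(\<lambda>n. cosh (\<theta> n / 2)) \<longlonglongrightarrow> 1"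
    using shelf_bounds_tendsto[OF \<open>c > 0\<close>] unfolding err_def c0_def \<theta>_def by blast+
  have C: "C \<longlonglongrightarrow> exp (1 / (8 * c\<^sup>2))"
    using cosh_power_tendsto[of "2 * c"] \<open>c > 0\<close>
    by (simp add: C_def[abs_def] \<theta>_def power_mult_distrib mult_ac)
  have "(\<lambda>n. (1 + cosh (\<theta> n) ^ n) * (1 / real n)) \<longlonglongrightarrow> (1 + exp (1 / (2 * c\<^sup>2))) * 0"
    unfolding \<theta>_def by (intro tendsto_intros cosh_power_tendsto[OF \<open>c > 0\<close>] lim_1_over_n)
  then have D: "D \<longlonglongrightarrow> 0"
    by (simp add: D_def[abs_def])
  have "?lo \<longlonglongrightarrow> exp (- 0 - 1 / (24 * c\<^sup>2)) * (1 - 0)"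
    by (intro tendsto_intros err c0 D)
  then have lo: "?lo \<longlonglongrightarrow> ?l"
    by simp
  have "?up' \<longlonglongrightarrow> exp (0 - 1 / (24 * c\<^sup>2)) * 1"
    by (intro tendsto_intros err c0 cosh1)
  then have up': "?up' \<longlonglongrightarrow> ?l"
    by simp
  \<comment> \<open>In the exponent, -1/24 + 1/8 = 1/12.\<close>
  have u: "exp (- (1 / (24 * c\<^sup>2))) * exp (1 / (8 * c\<^sup>2)) = ?u"
    using \<open>c > 0\<close> by (simp add: field_simps flip: exp_add)
  have "?up \<longlonglongrightarrow> exp (0 - 1 / (24 * c\<^sup>2)) * exp (1 / (8 * c\<^sup>2))"
    by (intro tendsto_intros err c0 C)
  then have up: "?up \<longlonglongrightarrow> ?u"
    using u by simp
  have "?lo' \<longlonglongrightarrow> exp (- 0 - 1 / (24 * c\<^sup>2)) * (exp (1 / (8 * c\<^sup>2)) / 1 - 0)"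
    by (intro tendsto_intros err c0 C D cosh1) simp
  then have lo': "?lo' \<longlonglongrightarrow> ?u"
    using u by simp
  have F: "F \<le> sequentially"
    unfolding F_def by simp
  have fin: "finite (sym_group n)" for n
    unfolding sym_group_def by (simp add: finite_permutations)
  have pos: "1 - ?l > 0" "?u - 1 > 0"
    using \<open>c > 0\<close> by simp_all
  have lu: "1 - ?l \<le> ?u - 1"
  proof -
    \<comment> \<open>Linear bounds suffice: 1 - l \<le> 1/(24c^2) \<le> 1/(12c^2) \<le> u -
      1.\<close>
    have "1 + (- 1 / (24 * c\<^sup>2)) \<le> ?l" "1 + 1 / (12 * c\<^sup>2) \<le> ?u"
      by (rule exp_ge_add_one_self)+
    moreover have "1 / (24 * c\<^sup>2) \<le> 1 / (12 * c\<^sup>2)"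
      using \<open>c > 0\<close> by (simp add: field_simps)
    ultimately show ?thesis
      by linarith
  qed
  have "\<theta> \<longlonglongrightarrow> 0"
    using \<open>c > 0\<close> unfolding \<theta>_def by real_asymp
  then have "\<forall>\<^sub>F n in sequentially. \<theta> n < 1 / 2"
    by (rule order_tendstoD) simp
  then have "\<forall>\<^sub>F n in F. \<theta> n < 1 / 2 \<and> n > 0"
    by (intro filter_leD[OF F] eventually_conj eventually_gt_at_top)
  moreover have "\<forall>\<^sub>F n in F. real (m n) = c * real n powr (3 / 2)"
    unfolding F_def by (simp add: eventually_inf_principal)
  ultimately have bounds: "\<forall>\<^sub>F n in F. (\<forall>w\<in>sym_group n. ?lo n \<le> ?f n w \<and> ?f n w \<le> ?up n) \<and>
      (\<exists>w\<in>sym_group n. ?lo' n \<le> ?f n w) \<and> (\<exists>w\<in>sym_group n. ?f n w \<le> ?up' n)"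
  proof eventually_elim
    case (elim n)
    then obtain i where n: "n = Suc i"
      by (cases n) auto
    have \<theta>: "0 < \<theta> n" "\<theta> n \<le> 1 / 2"
      using elim \<open>c > 0\<close> by (auto simp: \<theta>_def)
    \<comment> \<open>Identifies c n^(3/2) with n/\<theta>, the form used in
      \<open>shelf_ratio_bounds\<close>.\<close>
    have "real n powr (3 / 2) = real n powr (1 + 1 / 2)"
      by simp
    also have "\<dots> = real n * sqrt (real n)"
      using elim unfolding powr_add by (simp add: powr_half_sqrt)
    finally have m: "real (m n) = real n / \<theta> n"
      using elim by (simp add: \<theta>_def)
    moreover have "real n / \<theta> n > 0"
      using \<theta> elim by simp
    ultimately have m_pos: "m n > 0"
      by simp
    have f: "?f n w = shelf_ratio n (i - 2 * valleys (descent w) i) (real n / \<theta> n)"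
      if "w \<in> sym_group n" for w
      using pmf_shelf_shuffle_div_uniform[of w i "m n"] that m_pos m
      unfolding n sym_group_def by simp
    have upper: "shelf_ratio n k (real n / \<theta> n) \<le> exp (err n - c0 n) * cosh (\<theta> n / 2) ^ k"
      and lower: "exp (- err n - c0 n) * (cosh (\<theta> n / 2) ^ k - D n) \<le> shelf_ratio n k (real n / \<theta> n)"
      if "k \<le> i" for k
    proof -
      have "k < n"
        using that n by simp
      note b = shelf_ratio_bounds[OF \<theta> this]
      show "shelf_ratio n k (real n / \<theta> n) \<le> exp (err n - c0 n) * cosh (\<theta> n / 2) ^ k"
        using b(1) by (simp add: err_def c0_def)
      \<comment> \<open>Raising the exponent to \<open>n\<close> makes the error \<open>D n\<close>
        uniform in \<open>k\<close>.\<close>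
      have "cosh (\<theta> n) ^ k \<le> cosh (\<theta> n) ^ n"
        using that n by (intro power_increasing) (auto simp: cosh_real_ge_1)
      then have "(1 + cosh (\<theta> n) ^ k) / real n \<le> D n"
        unfolding D_def by (intro divide_right_mono) auto
      then have "exp (- err n - c0 n) * (cosh (\<theta> n / 2) ^ k - D n) \<le>
          exp (- err n - c0 n) * (cosh (\<theta> n / 2) ^ k - (1 + cosh (\<theta> n) ^ k) / real n)"
        by (intro mult_left_mono) auto
      also have "\<dots> \<le> shelf_ratio n k (real n / \<theta> n)"
        using b(2) by (simp add: err_def c0_def)
      finally show "exp (- err n - c0 n) * (cosh (\<theta> n / 2) ^ k - D n) \<le> shelf_ratio n k (real n / \<theta> n)" .
    qed
    have "?lo n \<le> ?f n w \<and> ?f n w \<le> ?up n" if w: "w \<in> sym_group n" for w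
    proof -
      define k where "k = i - 2 * valleys (descent w) i"
      have k: "k \<le> i"
        by (simp add: k_def)
      have "?lo n \<le> exp (- err n - c0 n) * (cosh (\<theta> n / 2) ^ k - D n)"
        by (intro mult_left_mono) (auto simp: cosh_real_ge_1 one_le_power)
      moreover have "exp (err n - c0 n) * cosh (\<theta> n / 2) ^ k \<le> ?up n"
        unfolding C_def using k n
        by (intro mult_left_mono power_increasing) (auto simp: cosh_real_ge_1)
      ultimately show ?thesis
        unfolding f[OF w] k_def[symmetric] using upper[OF k] lower[OF k] by linarith
    qed
    moreover have "\<exists>w\<in>sym_group n. ?lo' n \<le> ?f n w"
    proof
      show id: "id \<in> sym_group n"
        by (simp add: sym_group_def permutes_id)
      have "C n / cosh (\<theta> n / 2) = cosh (\<theta> n / 2) ^ i"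
        by (simp add: C_def n)
      then show "?lo' n \<le> ?f n id"
        using lower[of i] unfolding f[OF id] valleys_id by simp
    qed
    moreover have "\<exists>w\<in>sym_group n. ?f n w \<le> ?up' n"
    proof
      show zigzag: "zigzag n \<in> sym_group n"
        using zigzag_permutes[of n] by (simp add: sym_group_def)
      define k where "k = i - 2 * valleys (descent (zigzag n)) i"
      have k: "k \<le> i" "k \<le> 1"
        using valleys_zigzag[of i] by (simp_all add: k_def n)
      have "exp (err n - c0 n) * cosh (\<theta> n / 2) ^ k \<le> exp (err n - c0 n) * cosh (\<theta> n / 2) ^ 1"
        using k by (intro mult_left_mono power_increasing) (auto simp: cosh_real_ge_1)
      from order_trans[OF upper[OF k(1)] this] show "?f n (zigzag n) \<le> ?up' n"
        unfolding f[OF zigzag] k_def[symmetric] by (simp only: power_one_right)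
    qed
    ultimately show ?case
      by blast
  qed
  note max = max_tendsto[OF F fin lo up lo' up' lu bounds]
  show ?thesis
    \<comment> \<open>Both limits are nonzero, so convergence gives asymptotic equivalence.\<close>
    using max pos by (intro conjI tendsto_imp_asymp_equiv_const) auto
qed

end
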